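(* Let $t,n,m$ be positive integers with $m=t(n-t)$. Then the complete bipartite graph $K_{t,n-t}$ is the unique (up to isomorphism) bipartite optimal graph in $\mathfrak{B}_{n,m}$.
   Context: All graphs are finite, simple and undirected. For a graph $G$ on $n$ vertices with adjacency matrix $\mathbf{A}(G)$, write $\det(\lambda I-\mathbf{A}(G))=\sum_{i=0}^n \mathbf{a}_i(G)\lambda^{n-i}$, so $\mathbf{a}_4(G)$ is the coefficient of $\lambda^{n-4}$. $\mathfrak{B}_{n,m}$ is the set of connected bipartite graphs with $n$ vertices and $m$ edges; $G\in\mathfrak{B}_{n,m}$ is bipartite optimal if $\mathbf{a}_4(G)=\min\{\mathbf{a}_4(H):H\in\mathfrak{B}_{n,m}\}$. *)

theory Defs
  imports
    "Graph_Theory.Graph_Theory"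
    "Jordan_Normal_Form.Char_Poly"
begin

text \<open>
  A finite simple undirected graph is a \<^locale>\<open>pair_graph\<close>: a finite, loop-free, symmetric
  digraph without parallel arcs. An undirected edge corresponds to two opposite arcs. Vertices
  are natural numbers, the vertex set being an arbitrary finite set of them, so every finite
  graph occurs up to isomorphism.
\<close>

definition edges :: "nat pair_pre_digraph \<Rightarrow> nat set set" where
  "edges G = (\<lambda>(u, v). {u, v}) ` parcs G"

definition bipartite :: "nat pair_pre_digraph \<Rightarrow> bool" where
  "bipartite G \<longleftrightarrow>
    (\<exists>U V. pverts G = U \<union> V \<and> U \<inter> V = {} \<and> parcs G \<subseteq> U \<times> V \<union> V \<times> U)"

text \<open>
  Rows and columns follow the increasing order of the vertices. Another order conjugates the
  matrix by a permutation matrix and leaves the characteristic polynomial unchanged.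
\<close>

definition adjacency_matrix :: "nat pair_pre_digraph \<Rightarrow> int mat" where
  "adjacency_matrix G =
    (let n = card (pverts G); vs = sorted_list_of_set (pverts G)
     in mat n n (\<lambda>(i, j). if (vs ! i, vs ! j) \<in> parcs G then 1 else 0))"

text \<open>
  The coefficient of \<open>\<lambda> ^ (n - i)\<close> in \<open>det (\<lambda> I - A(G))\<close>, where \<open>n\<close> is the number of vertices.
  It is 0 for \<open>i > n\<close>; the case distinction prevents truncated subtraction from returning the
  constant term instead.
\<close>

definition char_coeff :: "nat \<Rightarrow> nat pair_pre_digraph \<Rightarrow> int" where
  "char_coeff i G =
    (if i \<le> card (pverts G)
     then coeff (char_poly (adjacency_matrix G)) (card (pverts G) - i) else 0)"

definition connected_bipartite_graphs :: "nat \<Rightarrow> nat \<Rightarrow> nat pair_pre_digraph set" where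
  "connected_bipartite_graphs n m =
    {G. pair_graph G \<and> Digraph_Component.connected (with_proj G) \<and> bipartite G \<and>
        card (pverts G) = n \<and> card (edges G) = m}"

definition bipartite_optimal :: "nat \<Rightarrow> nat \<Rightarrow> nat pair_pre_digraph \<Rightarrow> bool" where
  "bipartite_optimal n m G \<longleftrightarrow>
    G \<in> connected_bipartite_graphs n m \<and>
    (\<forall>H \<in> connected_bipartite_graphs n m. char_coeff 4 G \<le> char_coeff 4 H)"

definition complete_bipartite :: "nat \<Rightarrow> nat \<Rightarrow> nat pair_pre_digraph" where
  "complete_bipartite a b =
    \<lparr> pverts = {0..<a + b},
      parcs = {0..<a} \<times> {a..<a + b} \<union> {a..<a + b} \<times> {0..<a} \<rparr>"

lemma pair_graph_complete_bipartite: "pair_graph (complete_bipartite a b)"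
  by unfold_locales (auto simp: complete_bipartite_def symmetric_def sym_def)

lemma complete_bipartite_digraph_complete_bipartite:
  "complete_bipartite_digraph a b (with_proj (complete_bipartite a b))"
proof -
  interpret pair_graph "complete_bipartite a b"
    by (rule pair_graph_complete_bipartite)
  have "{0..<a + b} = {0..<a} \<union> {a..<a + b}" "{0..<a} \<inter> {a..<a + b} = {}"
    by auto
  then show ?thesis
    unfolding complete_bipartite_digraph_def
    by (intro conjI pair_graphD_graph exI[of _ "{0..<a}"] exI[of _ "{a..<a + b}"])
      (simp_all add: complete_bipartite_def)
qed

end

theory Submission
  imports Defs "Jordan_Normal_Form.Schur_Decomposition"
begin

text \<open>
  The odd power sums of the eigenvalues of a bipartite graph vanish, so Newton's identities give
  \<open>24 a\<^sub>4 = 3 p\<^sub>2\<^sup>2 - 6 p\<^sub>4\<close>, where \<open>p\<^sub>2\<close> is twice the number \<open>m\<close> of edges and \<open>p\<^sub>4\<close> is the number of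
  closed 4-walks. Orient the edges from one colour class to the other. A closed 4-walk starting in
  the first class is a pair of edges \<open>(a, b), (c, d)\<close> whose crossing pairs \<open>(a, d), (c, b)\<close> are edges as
  well, so there are at most \<open>2 m\<^sup>2\<close> closed 4-walks and \<open>a\<^sub>4 \<ge> 0\<close>. Equality says that crossing is
  always possible; in a connected graph every vertex lies on an edge, so then all pairs between the
  two classes are edges. Finally, the sum \<open>n\<close> and the product \<open>m\<close> of the class sizes determine them.
\<close>

subsection \<open>Power sums and the characteristic polynomial\<close>

text \<open>Newton's identities solved for the signed elementary symmetric functions; the factors 2,
  6 and 24 clear denominators. Appending a factor changes each coefficient by a multiple of the
  preceding one, so the five identities go through a single induction.\<close>

lemma coeff_prod_linear_power_sums:
  fixes es :: "complex list"
  defines "q \<equiv> \<Prod>a\<leftarrow>es. [:1, - a:]" and "p \<equiv> \<lambda>k. \<Sum>a\<leftarrow>es. a ^ k"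
  shows "coeff q 0 = 1"
    and "coeff q 1 = - p 1"
    and "2 * coeff q 2 = (p 1)\<^sup>2 - p 2"
    and "6 * coeff q 3 = - (p 1 ^ 3) + 3 * p 1 * p 2 - 2 * p 3"
    and "24 * coeff q 4 = p 1 ^ 4 - 6 * (p 1)\<^sup>2 * p 2 + 3 * (p 2)\<^sup>2 + 8 * p 1 * p 3 - 6 * p 4"
  unfolding q_def p_def
proof (induction es)
  case (Cons a es)
  let ?q = "\<Prod>a\<leftarrow>es. [:1, - a:]" and ?p = "\<lambda>k. \<Sum>a\<leftarrow>es. a ^ k"
  have coeff_step: "coeff (\<Prod>a\<leftarrow>a # es. [:1, - a:]) (Suc i) = coeff ?q (Suc i) - a * coeff ?q i" for i
    by simp
  have c: "coeff (\<Prod>a\<leftarrow>a # es. [:1, - a:]) 1 = coeff ?q 1 - a * coeff ?q 0"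
    "coeff (\<Prod>a\<leftarrow>a # es. [:1, - a:]) 2 = coeff ?q 2 - a * coeff ?q 1"
    "coeff (\<Prod>a\<leftarrow>a # es. [:1, - a:]) 3 = coeff ?q 3 - a * coeff ?q 2"
    "coeff (\<Prod>a\<leftarrow>a # es. [:1, - a:]) 4 = coeff ?q 4 - a * coeff ?q 3"
    using coeff_step[of 0] coeff_step[of 1] coeff_step[of 2] coeff_step[of 3]
    by (simp_all add: numeral_eq_Suc)
  have p: "(\<Sum>a\<leftarrow>a # es. a ^ k) = a ^ k + ?p k" for k
    by simp
  show "coeff (\<Prod>a\<leftarrow>a # es. [:1, - a:]) 0 = 1"
    using Cons(1) by simp
  show "coeff (\<Prod>a\<leftarrow>a # es. [:1, - a:]) 1 = - (\<Sum>a\<leftarrow>a # es. a ^ 1)"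
    using Cons(1,2) unfolding c p by simp
  show "2 * coeff (\<Prod>a\<leftarrow>a # es. [:1, - a:]) 2
      = (\<Sum>a\<leftarrow>a # es. a ^ 1)\<^sup>2 - (\<Sum>a\<leftarrow>a # es. a ^ 2)"
    using Cons(2,3) unfolding c p
    by (simp add: right_diff_distrib) (simp add: algebra_simps power2_eq_square)
  show "6 * coeff (\<Prod>a\<leftarrow>a # es. [:1, - a:]) 3
      = - ((\<Sum>a\<leftarrow>a # es. a ^ 1) ^ 3) + 3 * (\<Sum>a\<leftarrow>a # es. a ^ 1) * (\<Sum>a\<leftarrow>a # es. a ^ 2)
        - 2 * (\<Sum>a\<leftarrow>a # es. a ^ 3)"
    proof -
    \<comment> \<open>The correction \<open>6 * a * coeff ?q 2\<close> is regrouped around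
      \<open>2 * coeff ?q 2\<close>, the form in which the induction hypothesis can rewrite
      it.\<close>
    have "6 * coeff (\<Prod>a\<leftarrow>a # es. [:1, - a:]) 3
        = 6 * coeff ?q 3 - 3 * a * (2 * coeff ?q 2)"
      unfolding c by simp
    then show ?thesis
      unfolding p Cons by (simp add: algebra_simps power2_eq_square power3_eq_cube)
  qed
  show "24 * coeff (\<Prod>a\<leftarrow>a # es. [:1, - a:]) 4
      = (\<Sum>a\<leftarrow>a # es. a ^ 1) ^ 4
        - 6 * (\<Sum>a\<leftarrow>a # es. a ^ 1)\<^sup>2 * (\<Sum>a\<leftarrow>a # es. a ^ 2)
        + 3 * (\<Sum>a\<leftarrow>a # es. a ^ 2)\<^sup>2
        + 8 * (\<Sum>a\<leftarrow>a # es. a ^ 1) * (\<Sum>a\<leftarrow>a # es. a ^ 3) - 6 * (\<Sum>a\<leftarrow>a # es. a ^ 4)"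
    proof -
    have "24 * coeff (\<Prod>a\<leftarrow>a # es. [:1, - a:]) 4
        = 24 * coeff ?q 4 - 4 * a * (6 * coeff ?q 3)"
      unfolding c by simp
    then show ?thesis
      unfolding p Cons
      by (simp add: algebra_simps power2_eq_square power3_eq_cube power4_eq_xxxx)
  qed
qed (simp_all add: numeral_eq_Suc)

lemma reflect_poly_prod_list:
  fixes ps :: "'a :: {comm_semiring_1, semiring_no_zero_divisors} poly list"
  shows "reflect_poly (prod_list ps) = (\<Prod>p\<leftarrow>ps. reflect_poly p)"
  by (induction ps) (simp_all add: reflect_poly_mult)

section \<open>Traces of matrix powers as power sums of eigenvalues\<close>

definition mat_trace :: "'a :: comm_monoid_add mat \<Rightarrow> 'a" where
  "mat_trace A = (\<Sum>i<dim_row A. A $$ (i, i))"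

lemma mult_mat_entry:
  assumes "A \<in> carrier_mat n n" "B \<in> carrier_mat n n" "i < n" "j < n"
  shows "(A * B) $$ (i, j) = (\<Sum>k<n. A $$ (i, k) * B $$ (k, j))"
  using assms by (simp add: scalar_prod_def lessThan_atLeast0)

lemma mat_trace_mult:
  assumes "A \<in> carrier_mat n n" "B \<in> carrier_mat n n"
  shows "mat_trace (A * B) = (\<Sum>i<n. \<Sum>k<n. A $$ (i, k) * B $$ (k, i))"
  using assms by (simp add: mat_trace_def mult_mat_entry del: index_mult_mat(1))

lemma mat_trace_mult_commute:
  fixes A B :: "'a :: comm_semiring_0 mat"
  assumes "A \<in> carrier_mat n n" "B \<in> carrier_mat n n"
  shows "mat_trace (A * B) = mat_trace (B * A)"
  unfolding mat_trace_mult[OF assms] mat_trace_mult[OF assms(2,1)]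
  by (subst sum.swap) (simp add: mult.commute)

text \<open>Since \<open>A = P * B * Q\<close> with \<open>Q * P = 1\<close>, moving
  \<open>Q\<close> to the front under the trace leaves \<open>B\<close>.\<close>

lemma mat_trace_similar:
  fixes A B :: "'a :: comm_ring_1 mat"
  assumes "similar_mat_wit A B P Q"
  shows "mat_trace A = mat_trace B"
proof -
  obtain n where n: "n = dim_row A"
    by simp
  note w = similar_mat_witD[OF n assms]
  have "mat_trace A = mat_trace (Q * (P * B))"
    unfolding w(3) using w by (intro mat_trace_mult_commute[of _ n]) auto
  also have "Q * (P * B) = (Q * P) * B"
    using w by (intro assoc_mult_mat[symmetric, of _ n n _ n _ n]) auto
  also have "\<dots> = B"
    using w by simp
  finally show ?thesis .
qed

lemma upper_triangular_pow:
  fixes A :: "'a :: comm_ring_1 mat"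
  assumes "A \<in> carrier_mat n n" "upper_triangular A"
  shows "upper_triangular (A ^\<^sub>m k) \<and> (\<forall>i<n. (A ^\<^sub>m k) $$ (i, i) = A $$ (i, i) ^ k)"
proof (induction k)
  case 0
  then show ?case
    using assms by simp
next
  case (Suc k)
  have C: "A ^\<^sub>m k \<in> carrier_mat n n"
    using assms by simp
  \<comment> \<open>A term of the product survives only if \<open>i\<close> \<le> \<open>l\<close>
    \<le> \<open>j\<close>. Below the diagonal there is no such \<open>l\<close>; on it only
    \<open>l = i\<close> remains.\<close>
  have z: "(A ^\<^sub>m k) $$ (i, l) * A $$ (l, j) = 0" if "i < n" "l < n" "l < i \<or> j < l" for i j l
    using that assms Suc C by (auto dest: upper_triangularD)
  have "(A ^\<^sub>m Suc k) $$ (i, j) = 0" if "j < i" "i < n" for i j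
    unfolding pow_mat.simps
    by (subst mult_mat_entry[OF C assms(1)]) (use that in \<open>auto intro!: sum.neutral z\<close>)
  moreover have "(A ^\<^sub>m Suc k) $$ (i, i) = A $$ (i, i) ^ Suc k" if "i < n" for i
  proof -
    have "(A ^\<^sub>m Suc k) $$ (i, i) = (\<Sum>l<n. (A ^\<^sub>m k) $$ (i, l) * A $$ (l, i))"
      unfolding pow_mat.simps using that by (subst mult_mat_entry[OF C assms(1)]) auto
    also have "\<dots> = (\<Sum>l\<in>{i}. (A ^\<^sub>m k) $$ (i, l) * A $$ (l, i))"
      using that by (intro sum.mono_neutral_right) (auto intro!: z)
    finally show ?thesis
      using Suc that by simp
  qed
  ultimately show ?case
    using assms(1) by (auto intro!: upper_triangularI simp del: pow_mat.simps)
qed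

text \<open>Schur decomposition makes \<open>A\<close> similar to a triangular matrix with diagonal
  \<open>es\<close>. Similarity passes to powers, and powers of a triangular matrix have the powers
  of the entries on the diagonal.\<close>

lemma mat_trace_pow_eigenvalues:
  fixes A :: "complex mat"
  assumes A: "A \<in> carrier_mat n n" and es: "char_poly A = (\<Prod>a\<leftarrow>es. [:- a, 1:])"
  shows "mat_trace (A ^\<^sub>m k) = (\<Sum>a\<leftarrow>es. a ^ k)"
proof -
  obtain B P Q where "schur_decomposition A es = (B, P, Q)"
    by (cases "schur_decomposition A es")
  from schur_decomposition[OF A es this]
  have w: "similar_mat_wit A B P Q" and ut: "upper_triangular B" and d: "diag_mat B = es"
    by auto
  have B: "B \<in> carrier_mat n n"
    using similar_mat_witD2[OF A w] by simp
  have "mat_trace (A ^\<^sub>m k) = mat_trace (B ^\<^sub>m k)"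
    by (rule mat_trace_similar[OF similar_mat_wit_pow[OF w]])
  also have "\<dots> = (\<Sum>i<n. B $$ (i, i) ^ k)"
    using upper_triangular_pow[OF B ut, of k] B by (simp add: mat_trace_def)
  also have "\<dots> = (\<Sum>a\<leftarrow>es. a ^ k)"
    using B by (simp add: d[symmetric] diag_mat_def comp_def interv_sum_list_conv_sum_set_nat
        lessThan_atLeast0)
  finally show ?thesis .
qed

text \<open>Over the complex numbers the characteristic polynomial splits. Its reversal is the
  product of the \<open>[:1, - a:]\<close>, and the fourth Newton identity loses every term
  containing the first or third power sum.\<close>

lemma char_poly_coeff_4_complex:
  fixes A :: "complex mat"
  assumes A: "A \<in> carrier_mat n n" and "mat_trace A = 0" and "mat_trace (A ^\<^sub>m 3) = 0"
  shows "24 * coeff (reflect_poly (char_poly A)) 4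
    = 3 * (mat_trace (A ^\<^sub>m 2))\<^sup>2 - 6 * mat_trace (A ^\<^sub>m 4)"
proof -
  obtain es where es: "char_poly A = (\<Prod>a\<leftarrow>es. [:- a, 1:])"
    using char_poly_factorized[OF A] by blast
  \<comment> \<open>The case \<open>a = 0\<close> is separate because the reversal then drops to the
    constant 1.\<close>
  have "reflect_poly [:- a, 1:] = [:1, - a:]" for a :: complex
    by (cases "a = 0") (simp_all add: reflect_poly_def)
  then have q: "reflect_poly (char_poly A) = (\<Prod>a\<leftarrow>es. [:1, - a:])"
    unfolding es reflect_poly_prod_list by (simp add: comp_def)
  have "A ^\<^sub>m 1 = A"
    using A by simp
  with assms have "(\<Sum>a\<leftarrow>es. a ^ 1) = 0" "(\<Sum>a\<leftarrow>es. a ^ 3) = 0"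
    using mat_trace_pow_eigenvalues[OF A es] by metis+
  then show ?thesis
    using coeff_prod_linear_power_sums(5)[of es]
    unfolding q mat_trace_pow_eigenvalues[OF A es] by simp
qed

text \<open>Eigenvalues require complex numbers. The embedding of the integers is injective and
  commutes with traces, powers and characteristic polynomials, so the identity descends.\<close>

lemma char_poly_coeff_4:
  fixes A :: "int mat"
  assumes A: "A \<in> carrier_mat n n" and "mat_trace A = 0" and "mat_trace (A ^\<^sub>m 3) = 0"
  shows "24 * coeff (reflect_poly (char_poly A)) 4
    = 3 * (mat_trace (A ^\<^sub>m 2))\<^sup>2 - 6 * mat_trace (A ^\<^sub>m 4)"
proof -
  let ?B = "map_mat complex_of_int A"
  have B: "?B \<in> carrier_mat n n"
    using A by simp
  have tr: "mat_trace (map_mat complex_of_int M) = of_int (mat_trace M)"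
    if "M \<in> carrier_mat n n" for M
    using that by (simp add: mat_trace_def)
  have pow: "mat_trace (?B ^\<^sub>m k) = of_int (mat_trace (A ^\<^sub>m k))" for k
    using tr[of "A ^\<^sub>m k"] A by (simp add: of_int_hom.mat_hom_pow[OF A])
  have "coeff (reflect_poly (char_poly ?B)) 4 = of_int (coeff (reflect_poly (char_poly A)) 4)"
    unfolding of_int_hom.char_poly_hom[OF A] by (simp add: coeff_reflect_poly)
  moreover have "mat_trace ?B = 0" "mat_trace (?B ^\<^sub>m 3) = 0"
    using assms by (simp_all add: tr[OF A] pow)
  ultimately have "complex_of_int (24 * coeff (reflect_poly (char_poly A)) 4)
      = of_int (3 * (mat_trace (A ^\<^sub>m 2))\<^sup>2 - 6 * mat_trace (A ^\<^sub>m 4))"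
    using char_poly_coeff_4_complex[OF B] by (simp add: pow)
  then show ?thesis
    by (simp only: of_int_eq_iff)
qed

subsection \<open>Closed walks in bipartite graphs\<close>

text \<open>Entries depend on list elements instead of positions; for a distinct list, products and
  traces become sums over vertices.\<close>

definition list_mat :: "'a list \<Rightarrow> ('a \<Rightarrow> 'a \<Rightarrow> 'b) \<Rightarrow> 'b mat" where
  "list_mat vs f = mat (length vs) (length vs) (\<lambda>(i, j). f (vs ! i) (vs ! j))"

lemma sum_nth_distinct:
  assumes "distinct vs"
  shows "(\<Sum>i<length vs. g (vs ! i)) = (\<Sum>v\<in>set vs. g v)"
  by (rule sum.reindex_bij_betw[OF bij_betw_nth[OF assms refl refl]])

lemma list_mat_carrier [simp]: "list_mat vs f \<in> carrier_mat (length vs) (length vs)"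
  by (simp add: list_mat_def)

lemma list_mat_mult:
  fixes f g :: "'a \<Rightarrow> 'a \<Rightarrow> 'b :: semiring_0"
  assumes "distinct vs"
  shows "list_mat vs f * list_mat vs g = list_mat vs (\<lambda>a c. \<Sum>b\<in>set vs. f a b * g b c)"
    (is "?L = ?R")
proof (rule eq_matI)
  fix i j assume "i < dim_row ?R" "j < dim_col ?R"
  then have ij: "i < length vs" "j < length vs"
    by (simp_all add: list_mat_def)
  have "?L $$ (i, j) = (\<Sum>k<length vs. list_mat vs f $$ (i, k) * list_mat vs g $$ (k, j))"
    by (rule mult_mat_entry) (use ij in simp_all)
  also have "\<dots> = (\<Sum>k<length vs. f (vs ! i) (vs ! k) * g (vs ! k) (vs ! j))"
    using ij by (simp add: list_mat_def)
  also have "\<dots> = (\<Sum>b\<in>set vs. f (vs ! i) b * g b (vs ! j))"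
    by (rule sum_nth_distinct[OF assms])
  finally show "?L $$ (i, j) = ?R $$ (i, j)"
    using ij by (simp add: list_mat_def)
qed (simp_all add: list_mat_def)

lemma mat_trace_list_mat:
  assumes "distinct vs"
  shows "mat_trace (list_mat vs f) = (\<Sum>v\<in>set vs. f v v)"
  using sum_nth_distinct[OF assms, of "\<lambda>v. f v v"]
  by (simp add: mat_trace_def list_mat_def)

lemma adjacency_matrix_list_mat:
  "adjacency_matrix G = list_mat (sorted_list_of_set (pverts G)) (\<lambda>u v. of_bool ((u, v) \<in> parcs G))"
  by (simp add: adjacency_matrix_def list_mat_def of_bool_def Let_def)

lemma adjacency_matrix_carrier:
  "adjacency_matrix G \<in> carrier_mat (card (pverts G)) (card (pverts G))"
  by (simp add: adjacency_matrix_def Let_def)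

text \<open>The characteristic polynomial is monic of degree \<open>n\<close>, so reversal moves
  index \<open>n - i\<close> to \<open>i\<close>. Beyond the degree both sides are 0.\<close>

lemma char_coeff_reflect_poly:
  "char_coeff i G = coeff (reflect_poly (char_poly (adjacency_matrix G))) i"
  using degree_monic_char_poly[OF adjacency_matrix_carrier, of G]
  by (auto simp: char_coeff_def coeff_reflect_poly)

section \<open>Traces of adjacency powers as numbers of closed walks\<close>

context pair_fin_digraph
begin

text \<open>Walks have a starting point and a direction and may repeat vertices, exactly as the
  trace of the fourth power counts them.\<close>

definition closed_4_walks :: "('a \<times> 'a \<times> 'a \<times> 'a) set" where
  "closed_4_walks =
    {(a, b, c, d). (a, b) \<in> parcs G \<and> (b, c) \<in> parcs G \<and> (c, d) \<in> parcs G \<and> (d, a) \<in> parcs G}"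

lemma finite_closed_4_walks: "finite closed_4_walks"
  by (rule finite_subset[of _ "pverts G \<times> pverts G \<times> pverts G \<times> pverts G"])
    (auto simp: closed_4_walks_def pair_finite_verts dest: in_arcsD1)

end

text \<open>Expanding the matrix product gives a sum over vertex tuples, and a product of 0/1
  entries indicates whether the tuple is a closed walk.\<close>

lemma
  assumes "pair_fin_digraph G"
  shows mat_trace_adjacency: "mat_trace (adjacency_matrix G) = int (card {v. (v, v) \<in> parcs G})"
    and mat_trace_adjacency_2:
      "mat_trace (adjacency_matrix G ^\<^sub>m 2) = int (card {(a, b). (a, b) \<in> parcs G \<and> (b, a) \<in> parcs G})"
    and mat_trace_adjacency_3:
      "mat_trace (adjacency_matrix G ^\<^sub>m 3)
        = int (card {(a, b, c). (a, b) \<in> parcs G \<and> (b, c) \<in> parcs G \<and> (c, a) \<in> parcs G})"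
    and mat_trace_adjacency_4:
      "mat_trace (adjacency_matrix G ^\<^sub>m 4) = int (card (pair_fin_digraph.closed_4_walks G))"
proof -
  interpret pair_fin_digraph G
    by fact
  define V where "V = pverts G"
  define vs where "vs = sorted_list_of_set V"
  define f :: "nat \<Rightarrow> nat \<Rightarrow> int" where "f u v = of_bool ((u, v) \<in> parcs G)" for u v
  have fin [simp]: "finite V"
    by (simp add: V_def pair_finite_verts)
  have vs: "distinct vs" "set vs = V"
    by (simp_all add: vs_def)
  have A: "adjacency_matrix G = list_mat vs f"
    by (simp add: adjacency_matrix_list_mat f_def[abs_def] vs_def V_def)
  have arcs: "parcs G \<subseteq> V \<times> V"
    by (auto simp: V_def dest: in_arcsD1 in_arcsD2)
  have A_pow: "list_mat vs f ^\<^sub>m 2 = list_mat vs f * list_mat vs f"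
    "list_mat vs f ^\<^sub>m 3 = list_mat vs f * list_mat vs f * list_mat vs f"
    "list_mat vs f ^\<^sub>m 4 = list_mat vs f * list_mat vs f * list_mat vs f * list_mat vs f"
    using list_mat_carrier[of vs f] by (simp_all add: numeral_eq_Suc)
  show "mat_trace (adjacency_matrix G) = int (card {v. (v, v) \<in> parcs G})"
  proof -
    have "mat_trace (adjacency_matrix G) = int (card (V \<inter> {v. (v, v) \<in> parcs G}))"
      unfolding A mat_trace_list_mat[OF vs(1)] vs(2) by (simp add: f_def)
    also have "V \<inter> {v. (v, v) \<in> parcs G} = {v. (v, v) \<in> parcs G}"
      using arcs by auto
    finally show ?thesis .
  qed
  show "mat_trace (adjacency_matrix G ^\<^sub>m 2)
      = int (card {(a, b). (a, b) \<in> parcs G \<and> (b, a) \<in> parcs G})"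
    (is "_ = int (card ?W)")
  proof -
    have "mat_trace (adjacency_matrix G ^\<^sub>m 2) = (\<Sum>a\<in>V. \<Sum>b\<in>V. f a b * f b a)"
      unfolding A A_pow list_mat_mult[OF vs(1)] mat_trace_list_mat[OF vs(1)] vs(2) ..
    also have "\<dots> = (\<Sum>(a, b)\<in>V \<times> V. f a b * f b a)"
      by (simp only: sum.cartesian_product)
    also have "\<dots> = (\<Sum>x\<in>V \<times> V. of_bool (x \<in> ?W))"
      by (intro sum.cong) (auto simp: f_def)
    also have "\<dots> = int (card (V \<times> V \<inter> ?W))"
      by (simp only: sum_of_bool_eq finite_SigmaI fin Collect_mem_eq)
    also have "V \<times> V \<inter> ?W = ?W"
      using arcs by auto
    finally show ?thesis .
  qed
  show "mat_trace (adjacency_matrix G ^\<^sub>m 3)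
      = int (card {(a, b, c). (a, b) \<in> parcs G \<and> (b, c) \<in> parcs G \<and> (c, a) \<in> parcs G})"
    (is "_ = int (card ?W)")
  proof -
    have "mat_trace (adjacency_matrix G ^\<^sub>m 3)
        = (\<Sum>a\<in>V. \<Sum>c\<in>V. (\<Sum>b\<in>V. f a b * f b c) * f c a)"
      unfolding A A_pow list_mat_mult[OF vs(1)] mat_trace_list_mat[OF vs(1)] vs(2) ..
    also have "\<dots> = (\<Sum>(a, c, b)\<in>V \<times> V \<times> V. f a b * f b c * f c a)"
      by (simp only: sum_distrib_right sum.cartesian_product split_def fst_conv snd_conv)
    \<comment> \<open>Iterated multiplication puts the sum over the intermediate vertex
      \<open>b\<close> innermost; reindexing restores the order of the walk. The fourth power is
      treated alike.\<close>
    also have "\<dots> = (\<Sum>(a, b, c)\<in>V \<times> V \<times> V. f a b * f b c * f c a)"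
      by (rule sum.reindex_bij_witness[of _ "\<lambda>(a, b, c). (a, c, b)" "\<lambda>(a, c, b). (a, b, c)"])
        auto
    also have "\<dots> = (\<Sum>x\<in>V \<times> V \<times> V. of_bool (x \<in> ?W))"
      by (intro sum.cong) (auto simp: f_def)
    also have "\<dots> = int (card (V \<times> V \<times> V \<inter> ?W))"
      by (simp only: sum_of_bool_eq finite_SigmaI fin Collect_mem_eq)
    also have "V \<times> V \<times> V \<inter> ?W = ?W"
      using arcs by auto
    finally show ?thesis .
  qed
  show "mat_trace (adjacency_matrix G ^\<^sub>m 4) = int (card closed_4_walks)"
  proof -
    have "mat_trace (adjacency_matrix G ^\<^sub>m 4)
        = (\<Sum>a\<in>V. \<Sum>d\<in>V. (\<Sum>c\<in>V. (\<Sum>b\<in>V. f a b * f b c) * f c d) * f d a)"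
      unfolding A A_pow list_mat_mult[OF vs(1)] mat_trace_list_mat[OF vs(1)] vs(2) ..
    also have "\<dots> = (\<Sum>(a, d, c, b)\<in>V \<times> V \<times> V \<times> V. f a b * f b c * f c d * f d a)"
      by (simp only: sum_distrib_right sum.cartesian_product split_def fst_conv snd_conv)
    also have "\<dots> = (\<Sum>(a, b, c, d)\<in>V \<times> V \<times> V \<times> V. f a b * f b c * f c d * f d a)"
      by (rule sum.reindex_bij_witness[of _ "\<lambda>(a, b, c, d). (a, d, c, b)" "\<lambda>(a, d, c, b). (a, b, c, d)"])
        auto
    also have "\<dots> = (\<Sum>x\<in>V \<times> V \<times> V \<times> V. of_bool (x \<in> closed_4_walks))"
      by (intro sum.cong) (auto simp: f_def closed_4_walks_def)
    also have "\<dots> = int (card (V \<times> V \<times> V \<times> V \<inter> closed_4_walks))"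
      by (simp only: sum_of_bool_eq finite_SigmaI fin Collect_mem_eq)
    also have "V \<times> V \<times> V \<times> V \<inter> closed_4_walks = closed_4_walks"
      using arcs by (auto simp: closed_4_walks_def)
    finally show ?thesis .
  qed
qed

section \<open>The fourth coefficient of a graph with given colour classes\<close>

locale bipartitioned_graph = pair_graph G for G :: "nat pair_pre_digraph" +
  fixes U V :: "nat set"
  assumes verts_eq: "pverts G = U \<union> V"
    and disjoint: "U \<inter> V = {}"
    and arcs_bipartite: "parcs G \<subseteq> U \<times> V \<union> V \<times> U"
begin

text \<open>Every edge occurs once, oriented from \<open>U\<close> to \<open>V\<close>; these are
  the positions of the ones in the biadjacency matrix.\<close>

definition UV_arcs :: "(nat \<times> nat) set" where
  "UV_arcs = parcs G \<inter> U \<times> V"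

text \<open>Two edges with a common endpoint always cross, since crossing returns the same two
  edges. Disjoint edges cross exactly when they are opposite sides of a 4-cycle.\<close>

definition crossing_pairs :: "((nat \<times> nat) \<times> (nat \<times> nat)) set" where
  "crossing_pairs =
    {((a, b), (c, d)). (a, b) \<in> UV_arcs \<and> (c, d) \<in> UV_arcs \<and> (c, b) \<in> UV_arcs \<and> (a, d) \<in> UV_arcs}"

lemma finite_UV_arcs: "finite UV_arcs"
  using pair_finite_arcs by (simp add: UV_arcs_def)

lemma crossing_pairs_subset: "crossing_pairs \<subseteq> UV_arcs \<times> UV_arcs"
  by (auto simp: crossing_pairs_def)

lemma in_parcs_iff: "(a, b) \<in> parcs G \<longleftrightarrow> (a, b) \<in> UV_arcs \<or> (b, a) \<in> UV_arcs"
  using arcs_bipartite by (auto simp: UV_arcs_def dest: arcs_symmetric)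

lemma UV_arcsD: "(a, b) \<in> UV_arcs \<Longrightarrow> a \<in> U \<and> b \<in> V \<and> a \<notin> V \<and> b \<notin> U"
  using disjoint by (auto simp: UV_arcs_def)

lemma parcs_eq: "parcs G = UV_arcs \<union> UV_arcs\<inverse>"
  by (auto simp: in_parcs_iff)

lemma card_parcs: "card (parcs G) = 2 * card UV_arcs"
proof -
  have "card (parcs G) = card UV_arcs + card (UV_arcs\<inverse>)"
    unfolding parcs_eq using finite_UV_arcs by (intro card_Un_disjoint) (auto dest: UV_arcsD)
  then show ?thesis
    by (simp add: card_inverse)
qed

lemma card_edges: "card (edges G) = card UV_arcs"
proof -
  have "edges G = (\<lambda>(u, v). {u, v}) ` UV_arcs"
    unfolding edges_def parcs_eq by (force simp: insert_commute)
  moreover have "inj_on (\<lambda>(u, v). {u, v}) UV_arcs"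
    using disjoint by (auto simp: inj_on_def doubleton_eq_iff UV_arcs_def)
  ultimately show ?thesis
    by (simp add: card_image)
qed

text \<open>The walks are split by the class of their first vertex. A walk from \<open>U\<close> is
  read off as two oriented edges directly, a walk from \<open>V\<close> after a shift by one
  vertex.\<close>

lemma card_closed_4_walks: "card closed_4_walks = 2 * card crossing_pairs"
proof -
  let ?W = "{w \<in> closed_4_walks. fst w \<in> U}" and ?W' = "{w \<in> closed_4_walks. fst w \<notin> U}"
  have "bij_betw (\<lambda>(a, b, c, d). ((a, b), (c, d))) ?W crossing_pairs"
    by (rule bij_betwI[where g = "\<lambda>((a, b), (c, d)). (a, b, c, d)"])
      (auto simp: closed_4_walks_def crossing_pairs_def in_parcs_iff dest: UV_arcsD)
  then have 1: "card ?W = card crossing_pairs"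
    by (rule bij_betw_same_card)
  have "bij_betw (\<lambda>(a, b, c, d). ((b, c), (d, a))) ?W' crossing_pairs"
    by (rule bij_betwI[where g = "\<lambda>((b, c), (d, a)). (a, b, c, d)"])
      (auto simp: closed_4_walks_def crossing_pairs_def in_parcs_iff dest: UV_arcsD)
  then have 2: "card ?W' = card crossing_pairs"
    by (rule bij_betw_same_card)
  have "closed_4_walks = ?W \<union> ?W'"
    by auto
  then have "card closed_4_walks = card (?W \<union> ?W')"
    by simp
  also have "\<dots> = card ?W + card ?W'"
    using finite_closed_4_walks by (intro card_Un_disjoint) auto
  finally show ?thesis
    using 1 2 by simp
qed

text \<open>
  The right-hand side counts every nonzero \<open>2 \<times> 2\<close> minor of the biadjacency matrix twice; such a
  minor of a 0/1 matrix is \<open>1\<close> or \<open>-1\<close>.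
\<close>

lemma char_coeff_4: "2 * char_coeff 4 G = int (card (UV_arcs \<times> UV_arcs - crossing_pairs))"
proof -
  note tr = mat_trace_adjacency mat_trace_adjacency_2 mat_trace_adjacency_3 mat_trace_adjacency_4
  note tr = tr[OF pair_fin_digraph_axioms]
  \<comment> \<open>Every arc changes the class, so closed walks of lengths 1 and 3 do not exist;
    this makes the odd traces vanish.\<close>
  have e1: "{v. (v, v) \<in> parcs G} = {}"
    by (auto simp: in_parcs_iff dest: UV_arcsD)
  have e2: "{(a, b). (a, b) \<in> parcs G \<and> (b, a) \<in> parcs G} = parcs G"
    by (auto dest: arcs_symmetric)
  have e3: "{(a, b, c). (a, b) \<in> parcs G \<and> (b, c) \<in> parcs G \<and> (c, a) \<in> parcs G} = {}"
    by (auto simp: in_parcs_iff dest: UV_arcsD)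
  \<comment> \<open>The second trace is the number of arcs, twice the number of edges; the whole
    equation is then divisible by 12.\<close>
  have "24 * char_coeff 4 G = 3 * (2 * int (card UV_arcs))\<^sup>2 - 6 * (2 * int (card crossing_pairs))"
    unfolding char_coeff_reflect_poly
    by (subst char_poly_coeff_4[OF adjacency_matrix_carrier])
      (simp_all add: tr e1 e2 e3 card_parcs card_closed_4_walks)
  then have "2 * char_coeff 4 G = (int (card UV_arcs))\<^sup>2 - int (card crossing_pairs)"
    by (simp add: power_mult_distrib)
  also have "\<dots> = int (card (UV_arcs \<times> UV_arcs) - card crossing_pairs)"
    using card_mono[OF _ crossing_pairs_subset] finite_UV_arcs
    by (simp add: of_nat_diff card_cartesian_product power2_eq_square)
  also have "card (UV_arcs \<times> UV_arcs) - card crossing_pairs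
      = card (UV_arcs \<times> UV_arcs - crossing_pairs)"
    using crossing_pairs_subset finite_UV_arcs
    by (intro card_Diff_subset[symmetric]) (auto intro: finite_subset)
  finally show ?thesis .
qed

lemma char_coeff_4_nonneg: "0 \<le> char_coeff 4 G"
  using char_coeff_4 by linarith

lemma char_coeff_4_eq_0_iff: "char_coeff 4 G = 0 \<longleftrightarrow> UV_arcs \<times> UV_arcs = crossing_pairs"
proof -
  have "char_coeff 4 G = 0 \<longleftrightarrow> card (UV_arcs \<times> UV_arcs - crossing_pairs) = 0"
    using char_coeff_4 by linarith
  also have "\<dots> \<longleftrightarrow> UV_arcs \<times> UV_arcs = crossing_pairs"
    using crossing_pairs_subset finite_UV_arcs by auto
  finally show ?thesis .
qed

text \<open>A path from \<open>u\<close> to a vertex of \<open>V\<close> is not trivial, and its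
  first arc leaves \<open>u\<close>. With \<open>V\<close> empty, the graph on one vertex would be a
  counterexample.\<close>

lemma exists_neighbour:
  assumes "Digraph_Component.connected (with_proj G)" and "u \<in> U" and "V \<noteq> {}"
  shows "\<exists>b. (u, b) \<in> UV_arcs"
proof -
  obtain v where v: "v \<in> V"
    using assms by blast
  have "strongly_connected (with_proj G)"
    using assms(1) pair_sym_arcs by (rule symmetric_connected_imp_strongly_connected[rotated])
  then have "u \<rightarrow>\<^sup>*\<^bsub>with_proj G\<^esub> v"
    using assms(2) v by (auto simp: strongly_connected_def verts_eq)
  moreover have "u \<noteq> v"
    using assms(2) v disjoint by auto
  ultimately obtain b where "(u, b) \<in> parcs G"
    by (auto elim: converse_reachable_cases)
  then show ?thesis
    using assms(2) by (auto simp: in_parcs_iff dest: UV_arcsD)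
qed

text \<open>Exchanging the classes transfers statements about \<open>U\<close> to \<open>V\<close>,
  such as the existence of neighbours.\<close>

lemma bipartitioned_graph_swap: "bipartitioned_graph G V U"
  using verts_eq disjoint arcs_bipartite by unfold_locales auto

lemma UV_arcs_swap: "bipartitioned_graph.UV_arcs G V U = UV_arcs\<inverse>"
  unfolding UV_arcs_def bipartitioned_graph.UV_arcs_def[OF bipartitioned_graph_swap]
  by (auto dest: arcs_symmetric)

lemma char_coeff_4_eq_0_imp_complete:
  assumes "Digraph_Component.connected (with_proj G)" and "char_coeff 4 G = 0"
  shows "UV_arcs = U \<times> V"
proof
  show "U \<times> V \<subseteq> UV_arcs"
  proof
    fix e assume "e \<in> U \<times> V"
    then obtain u v where e: "e = (u, v)" "u \<in> U" "v \<in> V"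
      by blast
    interpret swap: bipartitioned_graph G V U
      by (rule bipartitioned_graph_swap)
    obtain b where "(u, b) \<in> UV_arcs"
      using exists_neighbour[OF assms(1)] e by blast
    moreover obtain c where "(c, v) \<in> UV_arcs"
      using swap.exists_neighbour[OF assms(1)] e UV_arcs_swap by blast
    \<comment> \<open>Crossing the edges \<open>(u, b)\<close> and \<open>(c, v)\<close> produces
      the desired edge \<open>(u, v)\<close>.\<close>
    ultimately have "((u, b), (c, v)) \<in> crossing_pairs"
      using assms(2) char_coeff_4_eq_0_iff by blast
    then show "e \<in> UV_arcs"
      using e by (simp add: crossing_pairs_def)
  qed
qed (auto simp: UV_arcs_def)

lemma complete_imp_char_coeff_4_eq_0:
  assumes "UV_arcs = U \<times> V"
  shows "char_coeff 4 G = 0"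
  unfolding char_coeff_4_eq_0_iff by (auto simp: crossing_pairs_def assms)

text \<open>Bijections of the two classes onto consecutive intervals glue to a map \<open>h\<close>
  of the vertices. Both graphs have all arcs between their classes, so \<open>h\<close> carries arcs
  onto arcs.\<close>

lemma complete_imp_iso_complete_bipartite:
  assumes "UV_arcs = U \<times> V"
  shows "digraph_iso (with_proj G) (with_proj (complete_bipartite (card U) (card V)))"
proof -
  let ?a = "card U" and ?b = "card V"
  have fin: "finite U" "finite V"
    using pair_finite_verts by (simp_all add: verts_eq)
  obtain f where f: "bij_betw f U {0..<?a}"
    using ex_bij_betw_finite_nat[OF fin(1)] by blast
  obtain g where g: "bij_betw g V {?a..<?a + ?b}"
    using finite_same_card_bij[OF fin(2), of "{?a..<?a + ?b}"] by auto
  define h where "h x = (if x \<in> U then f x else g x)" for x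
  have bij_U: "bij_betw h U {0..<?a}"
    by (intro bij_betw_cong[THEN iffD1, OF _ f]) (simp add: h_def)
  have bij_V: "bij_betw h V {?a..<?a + ?b}"
    using disjoint by (intro bij_betw_cong[THEN iffD1, OF _ g]) (auto simp: h_def)
  have inj: "inj_on h (U \<union> V)"
    by (rule bij_betw_imp_inj_on[OF bij_betw_combine[OF bij_U bij_V]]) auto
  have hU: "h ` U = {0..<?a}" and hV: "h ` V = {?a..<?a + ?b}"
    using bij_U bij_V by (simp_all add: bij_betw_def)
  \<comment> \<open>Arcs are pairs of vertices, so \<open>h\<close> acts on them componentwise and
    the projections remain tail and head.\<close>
  let ?hom = "\<lparr>iso_verts = h, iso_arcs = map_prod h h, iso_head = snd, iso_tail = fst\<rparr>"
  have "digraph_isomorphism ?hom"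
    unfolding digraph_isomorphism_def
  proof (intro conjI)
    have "parcs G \<subseteq> (U \<union> V) \<times> (U \<union> V)"
      using arcs_bipartite by auto
    then show "inj_on (iso_arcs ?hom) (parcs G)"
      using map_prod_inj_on[OF inj inj] by (auto intro: inj_on_subset)
  qed (use inj in \<open>simp_all add: verts_eq wf_digraph_axioms\<close>)
  moreover have "map_prod h h ` parcs G = {0..<?a} \<times> {?a..<?a + ?b} \<union> {?a..<?a + ?b} \<times> {0..<?a}"
    unfolding parcs_eq assms
    by (simp add: converse_Times image_Un map_prod_surj_on[OF hU hV] map_prod_surj_on[OF hV hU])
  then have "app_iso ?hom (with_proj G) = with_proj (complete_bipartite ?a ?b)"
    using hU hV
    by (auto simp: app_iso_def with_proj_def complete_bipartite_def verts_eq image_Un)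
  ultimately show ?thesis
    unfolding digraph_iso_def by metis
qed

end

section \<open>Complete bipartite graphs attain the lower bound\<close>

lemma bipartitioned_complete_bipartite:
  "bipartitioned_graph (complete_bipartite a b) {0..<a} {a..<a + b}"
proof -
  interpret pair_graph "complete_bipartite a b"
    by (rule pair_graph_complete_bipartite)
  show ?thesis
    by unfold_locales (auto simp: complete_bipartite_def)
qed

lemma UV_arcs_complete_bipartite:
  "bipartitioned_graph.UV_arcs (complete_bipartite a b) {0..<a} {a..<a + b} = {0..<a} \<times> {a..<a + b}"
  unfolding bipartitioned_graph.UV_arcs_def[OF bipartitioned_complete_bipartite]
  by (auto simp: complete_bipartite_def)

lemma connected_complete_bipartite:
  assumes "0 < a" "0 < b"
  shows "Digraph_Component.connected (with_proj (complete_bipartite a b))"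
proof -
  let ?G = "with_proj (complete_bipartite a b)"
  interpret pair_graph "complete_bipartite a b"
    by (rule pair_graph_complete_bipartite)
  have arc: "u \<rightarrow>\<^sup>*\<^bsub>?G\<^esub> v" if "u < a \<and> a \<le> v \<and> v < a + b \<or> v < a \<and> a \<le> u \<and> u < a + b" for u v
    using that by (intro reachable_adjI) (auto simp: complete_bipartite_def)
  \<comment> \<open>Vertex 0 is in the first class and vertex \<open>a\<close> in the second. The
    second class is reached from 0 by one arc, the first by a detour through
    \<open>a\<close>.\<close>
  have from_0: "0 \<rightarrow>\<^sup>*\<^bsub>?G\<^esub> u" if "u < a + b" for u
  proof (cases "u < a")
    case True
    then show ?thesis
      using reachable_trans[OF arc[of 0 a] arc[of a u]] assms by simp
  next
    case False
    then show ?thesis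
      using arc assms that by simp
  qed
  have "strongly_connected ?G"
  proof
    fix u v assume "u \<in> verts ?G" "v \<in> verts ?G"
    then have "0 \<rightarrow>\<^sup>*\<^bsub>?G\<^esub> u" "0 \<rightarrow>\<^sup>*\<^bsub>?G\<^esub> v"
      using from_0 by (auto simp: complete_bipartite_def)
    then show "u \<rightarrow>\<^sup>*\<^bsub>?G\<^esub> v"
      using symmetric_reachable' reachable_trans by blast
  qed (use assms in \<open>simp add: complete_bipartite_def\<close>)
  then show ?thesis
    using reachable_mk_symmetric_eq[OF pair_sym_arcs]
    by (simp add: Digraph_Component.connected_def strongly_connected_def)
qed

lemma complete_bipartite_in_connected_bipartite_graphs:
  assumes "0 < a" "0 < b"
  shows "complete_bipartite a b \<in> connected_bipartite_graphs (a + b) (a * b)"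
proof -
  interpret bipartitioned_graph "complete_bipartite a b" "{0..<a}" "{a..<a + b}"
    by (rule bipartitioned_complete_bipartite)
  show ?thesis
    unfolding connected_bipartite_graphs_def bipartite_def mem_Collect_eq
  proof (intro conjI)
    show "\<exists>U V. pverts (complete_bipartite a b) = U \<union> V \<and> U \<inter> V = {}
        \<and> parcs (complete_bipartite a b) \<subseteq> U \<times> V \<union> V \<times> U"
      using verts_eq disjoint arcs_bipartite by blast
    show "card (edges (complete_bipartite a b)) = a * b"
      by (simp add: card_edges UV_arcs_complete_bipartite)
    show "card (pverts (complete_bipartite a b)) = a + b"
      by (simp add: complete_bipartite_def)
  qed (rule pair_graph_axioms connected_complete_bipartite[OF assms])+
qed

lemma char_coeff_4_complete_bipartite: "char_coeff 4 (complete_bipartite a b) = 0"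
  by (rule bipartitioned_graph.complete_imp_char_coeff_4_eq_0[OF bipartitioned_complete_bipartite
        UV_arcs_complete_bipartite])

section \<open>Optimality and uniqueness\<close>

lemma obtain_bipartition:
  assumes "G \<in> connected_bipartite_graphs n m"
  obtains U V where "bipartitioned_graph G U V"
proof -
  obtain U V where "pverts G = U \<union> V" "U \<inter> V = {}" "parcs G \<subseteq> U \<times> V \<union> V \<times> U"
    using assms by (auto simp: connected_bipartite_graphs_def bipartite_def)
  moreover have "pair_graph G"
    using assms by (simp add: connected_bipartite_graphs_def)
  ultimately show thesis
    by (intro that[of U V] bipartitioned_graph.intro bipartitioned_graph_axioms.intro)
qed

text \<open>Both pairs are the roots of one monic quadratic: \<open>a\<close> satisfies
  \<open>(a - c) * (a - d) = 0\<close>, and an integral domain has no zero divisors.\<close>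

lemma sum_product_determines_pair:
  fixes a b c d :: "'a :: idom"
  assumes "a + b = c + d" and "a * b = c * d"
  shows "a = c \<and> b = d \<or> a = d \<and> b = c"
proof -
  have b: "b = c + d - a"
    using assms(1) by (simp add: eq_diff_eq add.commute)
  have "(a - c) * (a - d) = 0"
    using assms(2) unfolding b by (simp add: algebra_simps)
  then show ?thesis
    using b by auto
qed

theorem theorem5p1:
  fixes t n m :: nat
  assumes "0 < t" and "0 < n" and "0 < m"
    and "int m = int t * (int n - int t)"
  shows "bipartite_optimal n m (complete_bipartite t (n - t)) \<and>
    (\<forall>G. bipartite_optimal n m G \<longrightarrow>
      digraph_iso (with_proj G) (with_proj (complete_bipartite t (n - t))))"
proof -
  \<comment> \<open>The hypothesis subtracts in the integers, so positivity of \<open>m\<close>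
    forces \<open>t < n\<close> and the natural number \<open>n - t\<close> is not
    truncated.\<close>
  have "0 < int t * (int n - int t)"
    using assms by linarith
  then have "t < n"
    using assms(1) by (simp add: zero_less_mult_iff)
  then have s: "0 < n - t" "t + (n - t) = n"
    by simp_all
  have "int m = int (t * (n - t))"
    using assms(4) \<open>t < n\<close> by simp
  then have m: "m = t * (n - t)"
    by (simp only: of_nat_eq_iff)
  let ?K = "complete_bipartite t (n - t)"
  have K: "?K \<in> connected_bipartite_graphs n m"
    using complete_bipartite_in_connected_bipartite_graphs[OF assms(1) s(1)] s(2) m by simp
  have nonneg: "0 \<le> char_coeff 4 H" if "H \<in> connected_bipartite_graphs n m" for H
    using that by (elim obtain_bipartition) (rule bipartitioned_graph.char_coeff_4_nonneg)
  show ?thesis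
  proof (intro conjI allI impI)
    show "bipartite_optimal n m ?K"
      using K nonneg by (simp add: bipartite_optimal_def char_coeff_4_complete_bipartite)
  next
    fix G assume opt: "bipartite_optimal n m G"
    then have G: "G \<in> connected_bipartite_graphs n m"
      by (simp add: bipartite_optimal_def)
    obtain U V where "bipartitioned_graph G U V"
      using G by (rule obtain_bipartition)
    interpret bipartitioned_graph G U V
      by fact
    interpret swap: bipartitioned_graph G V U
      by (rule bipartitioned_graph_swap)
    have conn: "Digraph_Component.connected (with_proj G)"
      and card_G: "card (pverts G) = n" "card (edges G) = m"
      using G by (simp_all add: connected_bipartite_graphs_def)
    \<comment> \<open>The graph \<open>?K\<close> is a competitor with coefficient 0, so an optimal
      graph meets the lower bound.\<close>
    have "char_coeff 4 G \<le> 0"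
      using opt K char_coeff_4_complete_bipartite by (metis bipartite_optimal_def)
    with nonneg[OF G] have c: "char_coeff 4 G = 0"
      by simp
    have complete: "UV_arcs = U \<times> V" "swap.UV_arcs = V \<times> U"
      using char_coeff_4_eq_0_imp_complete swap.char_coeff_4_eq_0_imp_complete conn c by blast+
    have "finite U" "finite V"
      using pair_finite_verts by (simp_all add: verts_eq)
    then have "card U + card V = t + (n - t)"
      using card_G(1) s(2) disjoint by (simp add: verts_eq card_Un_disjoint)
    moreover have "card U * card V = t * (n - t)"
      using card_G(2) by (simp add: card_edges complete m card_cartesian_product)
    ultimately have "card U = t \<and> card V = n - t \<or> card U = n - t \<and> card V = t"
      using sum_product_determines_pair[of "int (card U)" "int (card V)" "int t" "int (n - t)"]
      by (simp only: of_nat_eq_iff flip: of_nat_add of_nat_mult)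
    \<comment> \<open>If \<open>U\<close> has \<open>n - t\<close> elements, the interpretation with
      exchanged classes gives the isomorphism, with \<open>V\<close> as the first class.\<close>
    then show "digraph_iso (with_proj G) (with_proj ?K)"
      using complete_imp_iso_complete_bipartite[OF complete(1)]
        swap.complete_imp_iso_complete_bipartite[OF complete(2)] by auto
  qed
qed

end
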